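(* Let $d\ge2$ and $r>0$, and let $\|\cdot\|$ be either the $\ell^2$-norm (hard spheres) or the $\ell^\infty$-norm (hard cubes) on $\mathbb{R}^d$. Let $\phi(x,y)=+\infty$ if $\|x-y\|<r$ and $\phi(x,y)=0$ otherwise. Then $$\Delta_\phi<\big(1-(1/8)^{d+1}\big)\,C_\phi.$$
   Context: $\mathbb{R}^d$ carries Lebesgue measure and the metric $\operatorname{dist}(x,y)=\|x-y\|$ given by the norm chosen in the definition of $\phi$. Conventions: $e^{-\infty}=0$, $0\cdot(+\infty)=0$, empty sums are $0$. $C_\phi=\sup_{v}\int_{\mathbb{R}^d}|1-e^{-\phi(x,v)}|\,dx$ (here, the volume of the $\|\cdot\|$-ball of radius $r$). For $k\ge1$, $$V_k:=\sup_{v_0}\int_{(\mathbb{R}^d)^k}\prod_{j=1}^k\left(\exp\Big(-\sum_{i=0}^{j-2}\mathbf{1}_{\operatorname{dist}(v_j,v_i)<\operatorname{dist}(v_i,v_{i+1})}\,\phi(v_j,v_i)\Big)\cdot\big(1-e^{-\phi(v_j,v_{j-1})}\big)\right)dv_1\cdots dv_k,$$ and $\Delta_\phi:=\lim_{k\to\infty}V_k^{1/k}=\inf_{k\ge1}V_k^{1/k}$. *)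

theory Defs
  imports "HOL-Analysis.Analysis"
begin

text \<open>
  Repulsive pair potentials take values in [0, +infinity], rendered as \<^typ>\<open>ennreal\<close>, where
  0 * infinity = 0. The value \<open>exp_neg t\<close> is exp(-t), with exp(-infinity) = 0.
\<close>

definition exp_neg :: "ennreal \<Rightarrow> real" where
  "exp_neg t = (if t = \<infinity> then 0 else exp (- enn2real t))"

text \<open>The k-th root on [0, +infinity] (for k > 0), with infinity mapped to infinity.\<close>

definition ennroot :: "nat \<Rightarrow> ennreal \<Rightarrow> ennreal" where
  "ennroot k x = (if x = \<infinity> then \<infinity> else ennreal (root k (enn2real x)))"

definition temperedness :: "('a::euclidean_space \<Rightarrow> 'a \<Rightarrow> ennreal) \<Rightarrow> ennreal" where
  "temperedness \<phi> = (SUP v. \<integral>\<^sup>+ x. ennreal \<bar>1 - exp_neg (\<phi> x v)\<bar> \<partial>lborel)"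

text \<open>
  The weight of a walk \<open>w 0, ..., w k\<close>. The inner index runs over \<open>0 \<le> i \<le> j - 2\<close>; it is written
  \<open>i < j - 1\<close> so that the sum is empty for \<open>j = 1\<close> despite truncated subtraction.
\<close>

definition walk_weight ::
  "('a \<Rightarrow> 'a \<Rightarrow> real) \<Rightarrow> ('a \<Rightarrow> 'a \<Rightarrow> ennreal) \<Rightarrow> nat \<Rightarrow> (nat \<Rightarrow> 'a) \<Rightarrow> real" where
  "walk_weight \<delta> \<phi> k w =
     (\<Prod>j=1..k.
        exp_neg (\<Sum>i<j - 1. of_bool (\<delta> (w j) (w i) < \<delta> (w i) (w (i + 1))) * \<phi> (w j) (w i))
        * (1 - exp_neg (\<phi> (w j) (w (j - 1)))))"

text \<open>
  The quantity \<open>V\<^sub>k\<close>: the integration variable \<open>v\<close> ranges over families indexed by \<open>{1..k}\<close>,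
  and \<open>v(0 := v0)\<close> prepends the starting point.
\<close>

definition walk_volume ::
  "('a::euclidean_space \<Rightarrow> 'a \<Rightarrow> real) \<Rightarrow> ('a \<Rightarrow> 'a \<Rightarrow> ennreal) \<Rightarrow> nat \<Rightarrow> ennreal" where
  "walk_volume \<delta> \<phi> k =
     (SUP v0. \<integral>\<^sup>+ v. ennreal (walk_weight \<delta> \<phi> k (v(0 := v0))) \<partial>(\<Pi>\<^sub>M j\<in>{1..k}. lborel))"

definition connective_constant ::
  "('a::euclidean_space \<Rightarrow> 'a \<Rightarrow> real) \<Rightarrow> ('a \<Rightarrow> 'a \<Rightarrow> ennreal) \<Rightarrow> ennreal" where
  "connective_constant \<delta> \<phi> = lim (\<lambda>k. ennroot k (walk_volume \<delta> \<phi> k))"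

definition hard_potential :: "('a::ab_group_add \<Rightarrow> real) \<Rightarrow> real \<Rightarrow> 'a \<Rightarrow> 'a \<Rightarrow> ennreal" where
  "hard_potential N r x y = (if N (x - y) < r then \<infinity> else 0)"

end

theory Submission
  imports Defs
begin

text \<open>
  Discarding the constraints between the first \<open>m\<close> and the last \<open>n\<close> steps of a walk shows
  \<open>V\<^sub>m\<^sub>+\<^sub>n \<le> V\<^sub>m V\<^sub>n\<close>, so by Fekete's argument the limit exists and is at most
  \<open>sqrt V\<^sub>2\<close>. The one constraint present in \<open>V\<^sub>2\<close> already forbids a ball of volume \<open>4\<^sup>-\<^sup>d C\<close>
  whenever the first step has length at least \<open>r/2\<close>, giving
  \<open>V\<^sub>2 \<le> (1 - 4\<^sup>-\<^sup>d (1 - 2\<^sup>-\<^sup>d)) C\<^sup>2\<close>.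
\<close>

section \<open>Submultiplicative sequences\<close>

text \<open>Blocks of length \<open>m\<close> are peeled off \<open>n\<close> until the remainder is
  below \<open>m\<close>. Each block costs a factor of at most \<open>c ^ m\<close>, and the
  remainder is absorbed into \<open>K\<close>.\<close>

lemma submultiplicative_le_geometric:
  fixes a :: "nat \<Rightarrow> real" and c :: real
  assumes nonneg: "\<And>n. a n \<ge> 0" and submult: "\<And>m n. a (m + n) \<le> a m * a n"
    and m: "m \<ge> 1" and c: "c > 0" "a m \<le> c ^ m"
  shows "\<exists>K>0. \<forall>n. a n \<le> K * c ^ n"
proof -
  \<comment> \<open>The sum dominates \<open>a s / c ^ s\<close> for every possible remainder
    \<open>s\<close>. The summand 1 keeps \<open>K\<close> positive even if all these terms vanish,
    so that \<open>root n K\<close> tends to 1 later.\<close>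
  define K where "K = 1 + (\<Sum>s<m. a s / c ^ s)"
  have K: "K > 0"
    unfolding K_def using nonneg c by (intro add_pos_nonneg sum_nonneg) auto
  have "a n \<le> K * c ^ n" for n
  proof (induction n rule: less_induct)
    case (less n)
    show ?case
    proof (cases "n < m")
      case True
      have "a n / c ^ n \<le> (\<Sum>s<m. a s / c ^ s)"
        using True nonneg c by (intro member_le_sum) auto
      then have "a n / c ^ n \<le> K"
        unfolding K_def by simp
      then show ?thesis
        using c by (simp add: divide_le_eq)
    next
      case False
      then have "a n \<le> a m * a (n - m)"
        using submult[of m "n - m"] by simp
      also have "\<dots> \<le> c ^ m * (K * c ^ (n - m))"
        using less[of "n - m"] m False c nonneg by (intro mult_mono) auto
      also have "\<dots> = K * c ^ n"
        using False by (simp flip: power_add)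
      finally show ?thesis .
    qed
  qed
  with K show ?thesis by blast
qed

text \<open>Fekete's lemma in multiplicative form. Working with roots instead of logarithms allows
  the sequence to take the value 0.\<close>

lemma submultiplicative_root_tendsto:
  fixes a :: "nat \<Rightarrow> real"
  assumes nonneg: "\<And>n. a n \<ge> 0" and submult: "\<And>m n. a (m + n) \<le> a m * a n"
  obtains L where "(\<lambda>n. root n (a n)) \<longlonglongrightarrow> L" and "\<And>m. m \<ge> 1 \<Longrightarrow> L \<le> root m (a m)"
proof -
  \<comment> \<open>The infimum starts at index 1 because \<open>root 0\<close> is constantly
    0.\<close>
  define L where "L = (INF n\<in>{1..}. root n (a n))"
  have bdd: "bdd_below ((\<lambda>n. root n (a n)) ` {1..})"
    using nonneg by (intro bdd_belowI[of _ 0]) auto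
  have le: "L \<le> root m (a m)" if "m \<ge> 1" for m
    unfolding L_def using bdd that by (intro cINF_lower) auto
  have L0: "L \<ge> 0"
    unfolding L_def using nonneg by (intro cINF_greatest) auto
  have "(\<lambda>n. root n (a n)) \<longlonglongrightarrow> L"
  proof (rule order_tendstoI)
    fix y assume "y < L"
    then show "\<forall>\<^sub>F n in sequentially. y < root n (a n)"
      using le by (intro eventually_sequentiallyI[of 1]) (meson less_le_trans)
  next
    fix y assume "L < y"
    \<comment> \<open>The gap between \<open>c\<close> and \<open>y\<close> leaves room for the
      factor \<open>root n K\<close>, which tends to 1.\<close>
    then obtain c where c: "L < c" "c < y"
      using dense by blast
    then have "\<exists>m\<in>{1..}. root m (a m) < c"
      using bdd unfolding L_def by (subst (asm) cINF_less_iff) auto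
    then obtain m where m: "m \<ge> 1" "root m (a m) < c" by auto
    have c0: "c > 0" using L0 c by linarith
    have "a m = root m (a m) ^ m"
      using m nonneg by simp
    also have "\<dots> \<le> c ^ m"
      using m nonneg by (intro power_mono) auto
    finally obtain K where K: "K > 0" "\<And>n. a n \<le> K * c ^ n"
      using submultiplicative_le_geometric[OF nonneg submult m(1) c0] by blast
    have "(\<lambda>n. root n K * c) \<longlonglongrightarrow> 1 * c"
      using K(1) by (intro tendsto_mult LIMSEQ_root_const tendsto_const)
    then have "\<forall>\<^sub>F n in sequentially. root n K * c < y"
      using c(2) by (intro order_tendstoD(2)[of _ "1 * c"]) simp_all
    then show "\<forall>\<^sub>F n in sequentially. root n (a n) < y"
      using eventually_ge_at_top[of 1]
    proof eventually_elim
      case (elim n)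
      have "root n (a n) \<le> root n (K * c ^ n)"
        using elim K(2) by simp
      also have "\<dots> = root n K * c"
        using elim c0 by (simp add: real_root_mult real_root_power_cancel)
      finally show ?case using elim by linarith
    qed
  qed
  with le show thesis using that by blast
qed

section \<open>Walk weights and volumes\<close>

lemma exp_neg_nonneg: "0 \<le> exp_neg t"
  and exp_neg_le_1: "exp_neg t \<le> 1"
  by (auto simp: exp_neg_def)

lemma exp_neg_antimono: "s \<le> t \<Longrightarrow> exp_neg t \<le> exp_neg s"
  by (auto simp: exp_neg_def top_unique less_top intro!: enn2real_mono)

lemma measurable_exp_neg [measurable]: "exp_neg \<in> borel_measurable borel"
  unfolding exp_neg_def[abs_def] by measurable

lemma walk_weight_nonneg: "0 \<le> walk_weight \<delta> \<phi> k w"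
  unfolding walk_weight_def
  by (intro prod_nonneg) (simp add: exp_neg_nonneg exp_neg_le_1)

lemma walk_weight_cong:
  assumes "\<And>i. i \<le> k \<Longrightarrow> w i = w' i"
  shows "walk_weight \<delta> \<phi> k w = walk_weight \<delta> \<phi> k w'"
  unfolding walk_weight_def
  by (intro prod.cong refl arg_cong2[where f = "(*)"] arg_cong[where f = exp_neg] sum.cong)
     (use assms in auto)

text \<open>Stated for an arbitrary family \<open>g\<close> because the integrands are evaluated at
  \<open>v(0 := p)\<close>, whose starting point is not a coordinate of the product space.\<close>

lemma measurable_walk_weight:
  fixes \<delta> :: "'a::euclidean_space \<Rightarrow> 'a \<Rightarrow> real"
  assumes [measurable]: "case_prod \<delta> \<in> borel_measurable (borel \<Otimes>\<^sub>M borel)"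
    "case_prod \<phi> \<in> borel_measurable (borel \<Otimes>\<^sub>M borel)"
    and g: "\<And>i. i \<le> k \<Longrightarrow> (\<lambda>z. g z i) \<in> borel_measurable M"
  shows "(\<lambda>z. walk_weight \<delta> \<phi> k (g z)) \<in> borel_measurable M"
  unfolding walk_weight_def
proof (intro borel_measurable_prod)
  fix j assume j: "j \<in> {1..k}"
  then have [measurable]: "(\<lambda>z. g z j) \<in> borel_measurable M"
      "(\<lambda>z. g z (j - 1)) \<in> borel_measurable M"
    using g by auto
  have "(\<lambda>z. \<Sum>i<j - 1. of_bool (\<delta> (g z j) (g z i) < \<delta> (g z i) (g z (i + 1))) * \<phi> (g z j) (g z i))
      \<in> borel_measurable M"
  proof (intro borel_measurable_sum)
    fix i assume i: "i \<in> {..<j - 1}"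
    then have [measurable]: "(\<lambda>z. g z i) \<in> borel_measurable M"
        "(\<lambda>z. g z (i + 1)) \<in> borel_measurable M"
      using g j by auto
    show "(\<lambda>z. of_bool (\<delta> (g z j) (g z i) < \<delta> (g z i) (g z (i + 1))) * \<phi> (g z j) (g z i))
        \<in> borel_measurable M"
      by measurable
  qed
  note [measurable] = this
  show "(\<lambda>z. exp_neg (\<Sum>i<j - 1. of_bool (\<delta> (g z j) (g z i) < \<delta> (g z i) (g z (i + 1))) * \<phi> (g z j) (g z i))
        * (1 - exp_neg (\<phi> (g z j) (g z (j - 1))))) \<in> borel_measurable M"
    by measurable
qed

section \<open>Submultiplicativity of the walk volumes\<close>

text \<open>The first \<open>m\<close> factors agree. In each later factor the exponent of the
  shifted walk is the part of the full sum with indices from \<open>m\<close> on. Dropping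
  nonnegative terms can only increase \<open>exp_neg\<close>.\<close>

lemma walk_weight_add_le:
  "walk_weight \<delta> \<phi> (m + n) w \<le> walk_weight \<delta> \<phi> m w * walk_weight \<delta> \<phi> n (\<lambda>i. w (m + i))"
proof -
  define t where "t w j = (\<lambda>i. of_bool (\<delta> (w j) (w i) < \<delta> (w i) (w (i + 1))) * \<phi> (w j) (w i))"
    for w and j :: nat
  define F where "F w j = exp_neg (\<Sum>i<j - 1. t w j i) * (1 - exp_neg (\<phi> (w j) (w (j - 1))))" for w and j :: nat
  have W: "walk_weight \<delta> \<phi> k w = prod (F w) {1..k}" for k w
    unfolding walk_weight_def F_def t_def by simp
  have F0: "0 \<le> F w j" for w j
    by (simp add: F_def exp_neg_nonneg exp_neg_le_1)
  have Fle: "F w (m + j) \<le> F (\<lambda>i. w (m + i)) j" if "j \<in> {1..n}" for j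
  proof -
    have "(\<Sum>i<j - 1. t (\<lambda>i. w (m + i)) j i) = (\<Sum>i<j - 1. t w (m + j) (m + i))"
      by (simp add: t_def)
    also have "\<dots> = (\<Sum>i\<in>(+) m ` {..<j - 1}. t w (m + j) i)"
      by (simp add: sum.reindex)
    also have "\<dots> \<le> (\<Sum>i<m + j - 1. t w (m + j) i)"
      using that by (intro sum_mono2) auto
    finally have "exp_neg (\<Sum>i<m + j - 1. t w (m + j) i) \<le> exp_neg (\<Sum>i<j - 1. t (\<lambda>i. w (m + i)) j i)"
      by (rule exp_neg_antimono)
    \<comment> \<open>As \<open>j\<close> is at least 1, the predecessor of \<open>m + j\<close> is
      the shifted predecessor of \<open>j\<close> despite truncated subtraction.\<close>
    moreover have "m + j - 1 = m + (j - 1)" using that by auto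
    ultimately show ?thesis
      unfolding F_def by (intro mult_mono) (auto simp: exp_neg_nonneg exp_neg_le_1)
  qed
  have "prod (F w) {1..m + n} = prod (F w) {1..m} * prod (F w) {m + 1..m + n}"
    by (subst prod.union_disjoint[symmetric]) (auto intro!: prod.cong)
  also have "prod (F w) {m + 1..m + n} = prod (\<lambda>j. F w (m + j)) {1..n}"
    by (intro prod.reindex_bij_witness[of _ "\<lambda>j. m + j" "\<lambda>j. j - m"]) auto
  also have "\<dots> \<le> prod (F (\<lambda>i. w (m + i))) {1..n}"
    using F0 Fle by (intro prod_mono) auto
  finally show ?thesis
    unfolding W using F0 by (simp add: mult_left_mono prod_nonneg)
qed

text \<open>Splitting off the last \<open>n\<close> variables leaves them indexed from
  \<open>m + 1\<close>, whereas \<open>walk_volume\<close> counts from 1. Relabelling preserves the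
  volume of boxes, and boxes determine the product measure.\<close>

lemma distr_PiM_lborel_shift:
  fixes m n :: nat
  shows "distr (\<Pi>\<^sub>M j\<in>{m + 1..m + n}. lborel :: 'a::euclidean_space measure) (\<Pi>\<^sub>M j\<in>{1..n}. lborel)
     (\<lambda>w. \<lambda>j\<in>{1..n}. w (m + j)) = (\<Pi>\<^sub>M j\<in>{1..n}. lborel)"
    (is "distr ?P ?Q ?f = ?Q")
proof -
  interpret product_sigma_finite "\<lambda>_::nat. lborel :: 'a measure"
    by standard
  have f: "?f \<in> measurable ?P ?Q"
    by (intro measurable_restrict measurable_component_singleton) auto
  show ?thesis
  proof (rule PiM_eqI)
    fix A :: "nat \<Rightarrow> 'a set" assume A: "\<And>i. i \<in> {1..n} \<Longrightarrow> A i \<in> sets lborel"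
    have "?f -` Pi\<^sub>E {1..n} A \<inter> space ?P = Pi\<^sub>E {m + 1..m + n} (\<lambda>j. A (j - m))"
    proof (intro equalityI subsetI)
      fix x assume x: "x \<in> ?f -` Pi\<^sub>E {1..n} A \<inter> space ?P"
      show "x \<in> Pi\<^sub>E {m + 1..m + n} (\<lambda>j. A (j - m))"
      proof (rule PiE_I)
        fix j assume j: "j \<in> {m + 1..m + n}"
        from x have "?f x (j - m) \<in> A (j - m)"
          using j by (intro PiE_mem[of _ "{1..n}" A]) auto
        then show "x j \<in> A (j - m)" using j by (auto split: if_splits)
      qed (use x in \<open>auto simp: space_PiM PiE_def extensional_def\<close>)
    next
      fix x assume x: "x \<in> Pi\<^sub>E {m + 1..m + n} (\<lambda>j. A (j - m))"
      have "x (m + i) \<in> A i" if "i \<in> {1..n}" for i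
        using PiE_mem[OF x, of "m + i"] that by auto
      with x show "x \<in> ?f -` Pi\<^sub>E {1..n} A \<inter> space ?P"
        by (auto simp: space_PiM PiE_def)
    qed
    then have "emeasure (distr ?P ?Q ?f) (Pi\<^sub>E {1..n} A) = emeasure ?P (Pi\<^sub>E {m + 1..m + n} (\<lambda>j. A (j - m)))"
      using A f by (simp add: emeasure_distr sets_PiM_I_finite)
    also have "\<dots> = (\<Prod>j\<in>{m + 1..m + n}. emeasure lborel (A (j - m)))"
    proof (intro emeasure_PiM)
      show "A (j - m) \<in> sets lborel" if "j \<in> {m + 1..m + n}" for j
        using that by (intro A) auto
    qed auto
    also have "\<dots> = (\<Prod>i\<in>{1..n}. emeasure lborel (A i))"
      by (intro prod.reindex_bij_witness[of _ "\<lambda>j. m + j" "\<lambda>j. j - m"]) auto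
    finally show "emeasure (distr ?P ?Q ?f) (Pi\<^sub>E {1..n} A) = (\<Prod>i\<in>{1..n}. emeasure lborel (A i))" .
  qed auto
qed

text \<open>By Tonelli, the last \<open>n\<close> variables are integrated first. They form a walk
  started at the endpoint of the first part, and the supremum in \<open>walk_volume\<close> bounds
  its integral uniformly in that endpoint.\<close>

lemma walk_volume_submult:
  fixes \<delta> :: "'a::euclidean_space \<Rightarrow> 'a \<Rightarrow> real"
  assumes meas: "case_prod \<delta> \<in> borel_measurable (borel \<Otimes>\<^sub>M borel)"
    "case_prod \<phi> \<in> borel_measurable (borel \<Otimes>\<^sub>M borel)"
  shows "walk_volume \<delta> \<phi> (m + n) \<le> walk_volume \<delta> \<phi> m * walk_volume \<delta> \<phi> n"
  unfolding walk_volume_def[of _ _ "m + n"]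
proof (rule SUP_least)
  fix v0 :: 'a
  interpret product_sigma_finite "\<lambda>_::nat. lborel :: 'a measure"
    by standard
  let ?M = "\<lambda>I. \<Pi>\<^sub>M j\<in>I. (lborel :: 'a measure)"
  let ?W = "walk_weight \<delta> \<phi>"
  define I J where "I = {1..m}" and "J = {m + 1..m + n}"
  define s where "s y = (\<lambda>j\<in>{1..n}. y (m + j))" for y :: "nat \<Rightarrow> 'a"
  have IJ: "{1..m + n} = I \<union> J" "I \<inter> J = {}" "finite I" "finite J"
    by (auto simp: I_def J_def)
  have meas_W: "(\<lambda>v. ennreal (?W k (v(0 := p)))) \<in> borel_measurable (?M {1..k})" for k p
  proof -
    have "(\<lambda>v. (v(0 := p)) i) \<in> borel_measurable (?M {1..k})" if "i \<le> k" for i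
      using that measurable_component_singleton[of i "{1..k}" "\<lambda>_. lborel :: 'a measure"]
      by (cases "i = 0") auto
    then show ?thesis
      by (intro measurable_compose[OF _ measurable_ennreal] measurable_walk_weight[OF meas]) auto
  qed
  have meas_s: "s \<in> measurable (?M J) (?M {1..n})"
    unfolding s_def J_def by (intro measurable_restrict measurable_component_singleton) auto
  \<comment> \<open>The endpoint is written \<open>(x(0 := v0)) m\<close> so that it is
    \<open>v0\<close> when \<open>m = 0\<close> and \<open>x m\<close> otherwise.\<close>
  have split: "?W (m + n) ((merge I J (x, y))(0 := v0)) \<le> ?W m (x(0 := v0)) * ?W n ((s y)(0 := (x(0 := v0)) m))"
    for x y
  proof -
    have "?W m ((merge I J (x, y))(0 := v0)) = ?W m (x(0 := v0))"
      by (rule walk_weight_cong) (auto simp: merge_def I_def)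
    moreover have "?W n (\<lambda>i. ((merge I J (x, y))(0 := v0)) (m + i)) = ?W n ((s y)(0 := (x(0 := v0)) m))"
      by (rule walk_weight_cong) (auto simp: merge_def I_def J_def s_def)
    ultimately show ?thesis
      using walk_weight_add_le[of \<delta> \<phi> m n "(merge I J (x, y))(0 := v0)"] by simp
  qed
  have tail: "(\<integral>\<^sup>+ y. ennreal (?W n ((s y)(0 := p))) \<partial>?M J) \<le> walk_volume \<delta> \<phi> n" for p
  proof -
    have "(\<integral>\<^sup>+ y. ennreal (?W n ((s y)(0 := p))) \<partial>?M J)
        = (\<integral>\<^sup>+ u. ennreal (?W n (u(0 := p))) \<partial>distr (?M J) (?M {1..n}) s)"
      using meas_s meas_W by (intro nn_integral_distr[symmetric]) auto
    also have "distr (?M J) (?M {1..n}) s = ?M {1..n}"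
      unfolding s_def[abs_def] J_def by (rule distr_PiM_lborel_shift)
    also have "(\<integral>\<^sup>+ u. ennreal (?W n (u(0 := p))) \<partial>?M {1..n}) \<le> walk_volume \<delta> \<phi> n"
      unfolding walk_volume_def by (rule SUP_upper) simp
    finally show ?thesis .
  qed
  have "(\<integral>\<^sup>+ v. ennreal (?W (m + n) (v(0 := v0))) \<partial>?M {1..m + n})
      = (\<integral>\<^sup>+ x. (\<integral>\<^sup>+ y. ennreal (?W (m + n) ((merge I J (x, y))(0 := v0))) \<partial>?M J) \<partial>?M I)"
    using meas_W[of "m + n" v0] unfolding IJ(1) by (intro product_nn_integral_fold IJ)
  also have "\<dots> \<le> (\<integral>\<^sup>+ x. (\<integral>\<^sup>+ y. ennreal (?W m (x(0 := v0))) * ennreal (?W n ((s y)(0 := (x(0 := v0)) m))) \<partial>?M J) \<partial>?M I)"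
    by (intro nn_integral_mono) (use split in \<open>simp add: walk_weight_nonneg flip: ennreal_mult\<close>)
  also have "\<dots> = (\<integral>\<^sup>+ x. ennreal (?W m (x(0 := v0))) * (\<integral>\<^sup>+ y. ennreal (?W n ((s y)(0 := (x(0 := v0)) m))) \<partial>?M J) \<partial>?M I)"
    using meas_s meas_W by (intro nn_integral_cong nn_integral_cmult measurable_compose[OF meas_s meas_W])
  also have "\<dots> \<le> (\<integral>\<^sup>+ x. ennreal (?W m (x(0 := v0))) * walk_volume \<delta> \<phi> n \<partial>?M I)"
    by (intro nn_integral_mono mult_left_mono tail) simp
  also have "\<dots> = (\<integral>\<^sup>+ x. ennreal (?W m (x(0 := v0))) \<partial>?M I) * walk_volume \<delta> \<phi> n"
    using meas_W unfolding I_def by (intro nn_integral_multc)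
  also have "\<dots> \<le> walk_volume \<delta> \<phi> m * walk_volume \<delta> \<phi> n"
    unfolding I_def walk_volume_def[of _ _ m] by (intro mult_right_mono SUP_upper) simp_all
  finally show "(\<integral>\<^sup>+ v. ennreal (?W (m + n) (v(0 := v0))) \<partial>?M {1..m + n})
      \<le> walk_volume \<delta> \<phi> m * walk_volume \<delta> \<phi> n" .
qed

section \<open>Finiteness of the volumes and existence of the limit\<close>

lemma walk_volume_0: "walk_volume \<delta> \<phi> 0 = 1"
proof -
  interpret product_sigma_finite "\<lambda>_::nat. lborel :: 'a measure"
    by standard
  show ?thesis
    using nn_integral_empty[of "\<lambda>_. 1"] by (simp add: walk_volume_def walk_weight_def)
qed

text \<open>A single step has no earlier constraint, and \<open>1 - exp_neg\<close> is nonnegative,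
  so the absolute value in \<open>temperedness\<close> changes nothing.\<close>

lemma walk_volume_1:
  fixes \<delta> :: "'a::euclidean_space \<Rightarrow> 'a \<Rightarrow> real"
  assumes [measurable]: "case_prod \<phi> \<in> borel_measurable (borel \<Otimes>\<^sub>M borel)"
  shows "walk_volume \<delta> \<phi> 1 = temperedness \<phi>"
proof -
  interpret product_sigma_finite "\<lambda>_::nat. lborel :: 'a measure"
    by standard
  have "(\<integral>\<^sup>+ v. ennreal (walk_weight \<delta> \<phi> 1 (v(0 := v0))) \<partial>(\<Pi>\<^sub>M j\<in>{1}. lborel))
      = (\<integral>\<^sup>+ x. ennreal \<bar>1 - exp_neg (\<phi> x v0)\<bar> \<partial>lborel)" for v0 :: 'a
    using product_nn_integral_singleton[of "\<lambda>x. ennreal \<bar>1 - exp_neg (\<phi> x v0)\<bar>" 1]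
    by (simp add: walk_weight_def exp_neg_le_1 exp_neg_def)
  then show ?thesis
    by (simp add: walk_volume_def temperedness_def)
qed

lemma walk_volume_finite:
  fixes \<delta> :: "'a::euclidean_space \<Rightarrow> 'a \<Rightarrow> real"
  assumes meas: "case_prod \<delta> \<in> borel_measurable (borel \<Otimes>\<^sub>M borel)"
    "case_prod \<phi> \<in> borel_measurable (borel \<Otimes>\<^sub>M borel)"
    and fin: "temperedness \<phi> < \<infinity>"
  shows "walk_volume \<delta> \<phi> k < \<infinity>"
proof (induction k)
  case 0
  then show ?case by (simp add: walk_volume_0)
next
  case (Suc k)
  have "walk_volume \<delta> \<phi> (k + 1) \<le> walk_volume \<delta> \<phi> k * walk_volume \<delta> \<phi> 1"
    by (rule walk_volume_submult[OF meas])
  also have "\<dots> < \<infinity>"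
    using Suc fin by (simp only: walk_volume_1[OF meas(2)]) (simp add: ennreal_mult_less_top)
  finally show ?case by simp
qed

text \<open>Finiteness moves the sequence to the reals, where Fekete's lemma applies. Convergence
  has to be proved before anything can be said of \<open>connective_constant\<close>, as
  \<open>lim\<close> is a definite description.\<close>

lemma connective_constant_le_root:
  fixes \<delta> :: "'a::euclidean_space \<Rightarrow> 'a \<Rightarrow> real"
  assumes meas: "case_prod \<delta> \<in> borel_measurable (borel \<Otimes>\<^sub>M borel)"
    "case_prod \<phi> \<in> borel_measurable (borel \<Otimes>\<^sub>M borel)"
    and fin: "temperedness \<phi> < \<infinity>" and m: "m \<ge> 1"
  shows "connective_constant \<delta> \<phi> \<le> ennroot m (walk_volume \<delta> \<phi> m)"
proof -
  define a where "a k = enn2real (walk_volume \<delta> \<phi> k)" for k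
  have V: "walk_volume \<delta> \<phi> k = ennreal (a k)" for k
    using walk_volume_finite[OF meas fin, of k] by (simp add: a_def)
  have a0: "a k \<ge> 0" for k
    by (simp add: a_def)
  have root: "ennroot k (walk_volume \<delta> \<phi> k) = ennreal (root k (a k))" for k
    using a0 by (simp add: ennroot_def V)
  have "a (k + n) \<le> a k * a n" for k n
    using walk_volume_submult[OF meas, of k n] a0 by (simp add: V flip: ennreal_mult)
  from submultiplicative_root_tendsto[of a, OF a0 this]
  obtain L where L: "(\<lambda>n. root n (a n)) \<longlonglongrightarrow> L" "\<And>m. m \<ge> 1 \<Longrightarrow> L \<le> root m (a m)"
    by blast
  have "connective_constant \<delta> \<phi> = ennreal L"
    unfolding connective_constant_def root using L(1) by (intro limI tendsto_ennrealI)
  then show ?thesis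
    unfolding root using L(2)[OF m] by (simp add: ennreal_leI)
qed

section \<open>Hard-core potentials of norms\<close>

text \<open>Treats both norms at once. Continuity makes the balls open, hence of positive volume;
  comparison with the Euclidean norm makes them bounded, hence of finite volume.\<close>

locale equivalent_norm =
  fixes N :: "'a::euclidean_space \<Rightarrow> real" and K :: real
  assumes scale: "N (c *\<^sub>R x) = \<bar>c\<bar> * N x"
    and triangle: "N (x + y) \<le> N x + N y"
    and continuous: "continuous_on UNIV N"
    and norm_le: "norm x \<le> K * N x"
begin

abbreviation nball :: "'a \<Rightarrow> real \<Rightarrow> 'a set" where
  "nball v s \<equiv> {x. N (x - v) < s}"

lemma measurable_N [measurable]: "N \<in> borel_measurable borel"
  using continuous by (rule borel_measurable_continuous_onI)

lemma minus: "N (- x) = N x"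
  using scale[of "-1" x] by simp

lemma zero: "N 0 = 0"
  using scale[of 0 0] by simp

lemma nonneg: "0 \<le> N x"
  using triangle[of x "- x"] by (simp add: minus zero)

lemma open_nball: "open (nball v s)"
  by (intro open_Collect_less continuous_on_compose2[OF continuous] continuous_intros) auto

section \<open>Volumes of balls\<close>

text \<open>The affine map with centre \<open>v\<close> and ratio \<open>t\<close> has Jacobian
  \<open>t ^ DIM('a)\<close>. The case \<open>t = 1\<close> is translation invariance;
  \<open>1 / 2\<close> and \<open>1 / 4\<close> give the balls in the estimate of the second walk
  volume.\<close>

lemma emeasure_nball_scale:
  assumes "t > 0"
  shows "emeasure lborel (nball v (t * s)) = ennreal (t ^ DIM('a)) * emeasure lborel (nball 0 s)"
proof -
  have "(\<lambda>x. v + t *\<^sub>R x) -` nball v (t * s) = nball 0 s"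
    using assms by (auto simp: scale)
  moreover have "nball v (t * s) \<in> sets borel"
    by (intro borel_open open_nball)
  ultimately show ?thesis
    using assms
    by (subst lborel_affine[of t v]) (auto simp: emeasure_density_const emeasure_distr)
qed

lemma emeasure_nball_finite:
  assumes "s > 0"
  shows "emeasure lborel (nball 0 s) < \<infinity>"
proof -
  have "K \<ge> 0"
  proof -
    obtain b :: 'a where "b \<in> Basis" using nonempty_Basis by blast
    then have "1 \<le> K * N b" using norm_le[of b] by simp
    then show ?thesis using nonneg[of b] by (smt (verit) mult_nonneg_nonpos2 mult.commute)
  qed
  then have "norm x \<le> K * s" if "x \<in> nball 0 s" for x
    using that by (intro order.trans[OF norm_le] mult_left_mono) auto
  then have "bounded (nball 0 s)"
    by (meson boundedI)
  then show ?thesis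
    using emeasure_bounded_finite by blast
qed

lemma emeasure_nball_pos:
  assumes "s > 0"
  shows "emeasure lborel (nball 0 s) > 0"
proof -
  have "nball 0 s \<noteq> {}" using assms zero by (auto intro: exI[of _ 0])
  then have "\<not> negligible (nball 0 s)"
    using open_nball open_not_negligible by blast
  then show ?thesis
    using open_nball[of 0 s]
    by (auto simp: negligible_iff_emeasure0 zero_less_iff_neq_zero)
qed

lemma measurable_hard_potential:
  "case_prod (hard_potential N r) \<in> borel_measurable (borel \<Otimes>\<^sub>M borel)"
  unfolding hard_potential_def by measurable

lemma measurable_metric: "(\<lambda>(x, y). N (x - y)) \<in> borel_measurable (borel \<Otimes>\<^sub>M borel)"
  by measurable

lemma emeasure_nball:
  assumes "s > 0"
  shows "emeasure lborel (nball v s) = emeasure lborel (nball 0 s)"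
  using emeasure_nball_scale[of 1 v s] by simp

section \<open>Walks of length two under the hard-core potential\<close>

lemma exp_neg_hard_potential: "exp_neg (hard_potential N r x y) = of_bool (r \<le> N (x - y))"
  by (simp add: hard_potential_def exp_neg_def)

lemma temperedness_hard_potential:
  assumes "r > 0"
  shows "temperedness (hard_potential N r) = emeasure lborel (nball 0 r)"
proof -
  have "(\<integral>\<^sup>+ x. ennreal \<bar>1 - exp_neg (hard_potential N r x v)\<bar> \<partial>lborel) = emeasure lborel (nball 0 r)" for v
  proof -
    have "(\<integral>\<^sup>+ x. ennreal \<bar>1 - exp_neg (hard_potential N r x v)\<bar> \<partial>lborel)
        = (\<integral>\<^sup>+ x. indicator (nball v r) x \<partial>lborel)"
      by (intro nn_integral_cong) (auto simp: exp_neg_hard_potential indicator_def)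
    also have "\<dots> = emeasure lborel (nball v r)"
      using open_nball by (intro nn_integral_indicator) auto
    finally show ?thesis using emeasure_nball[OF assms] by simp
  qed
  then show ?thesis by (simp add: temperedness_def)
qed

text \<open>
  If \<open>w 1\<close> is at distance at least \<open>r/2\<close> from \<open>w 0\<close>, then the ball of radius \<open>r/4\<close> around their
  midpoint is forbidden for \<open>w 2\<close>, although it lies within distance \<open>r\<close> of \<open>w 1\<close>.
\<close>

lemma walk_weight_2_le:
  "walk_weight (\<lambda>x y. N (x - y)) (hard_potential N r) 2 w
    \<le> of_bool (N (w 1 - w 0) < r \<and> N (w 2 - w 1) < r \<and>
        \<not> (r / 2 \<le> N (w 1 - w 0) \<and> N (w 2 - midpoint (w 0) (w 1)) < r / 4))"
proof -
  let ?d = "N (w 1 - w 0)"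
  have sym: "N (w 0 - w 1) = ?d"
    using minus[of "w 1 - w 0"] by simp
  have "midpoint (w 0) (w 1) - w 0 = (1 / 2) *\<^sub>R (w 1 - w 0)"
    by (simp add: midpoint_def algebra_simps flip: scaleR_add_left)
  then have "N (midpoint (w 0) (w 1) - w 0) = ?d / 2"
    by (simp add: scale)
  then have "N (w 2 - w 0) \<le> N (w 2 - midpoint (w 0) (w 1)) + ?d / 2"
    using triangle[of "w 2 - midpoint (w 0) (w 1)" "midpoint (w 0) (w 1) - w 0"] by simp
  \<comment> \<open>The bound is \<open>r / 4 + ?d / 2\<close>, which is at most \<open>?d\<close>
    once \<open>?d\<close> is at least \<open>r / 2\<close>. If also \<open>?d < r\<close>, then
    \<open>w 2\<close> lies within \<open>r\<close> of \<open>w 0\<close>, so the active constraint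
    is infinite and the weight vanishes.\<close>
  then have close: "N (w 2 - w 0) < ?d" if "r / 2 \<le> ?d" "N (w 2 - midpoint (w 0) (w 1)) < r / 4"
    using that by linarith
  have prod: "(\<Prod>j=1..2. f j) = f 1 * f 2" for f :: "nat \<Rightarrow> real"
    by (simp add: numeral_2_eq_2)
  have sum: "(\<Sum>i<2 - 1. f i) = f 0" for f :: "nat \<Rightarrow> ennreal"
    by simp
  have "walk_weight (\<lambda>x y. N (x - y)) (hard_potential N r) 2 w =
      (1 - of_bool (r \<le> ?d)) *
      (exp_neg (of_bool (N (w 2 - w 0) < ?d) * hard_potential N r (w 2) (w 0)) *
       (1 - of_bool (r \<le> N (w 2 - w 1))))"
    unfolding walk_weight_def prod sum by (simp add: exp_neg_hard_potential sym[unfolded One_nat_def] exp_neg_def[of 0])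
  then show ?thesis
    using close by (auto simp: exp_neg_hard_potential exp_neg_le_1)
qed

text \<open>Here \<open>p\<close> and \<open>h\<close> are the volume ratios of the balls of radius
  \<open>r / 4\<close> and \<open>r / 2\<close>. The second step has volume at most \<open>c\<close>
  if the first is shorter than \<open>r / 2\<close>, and at most \<open>c * (1 - p)\<close>
  otherwise. Only a fraction \<open>h\<close> of the first steps is that short.\<close>

lemma walk_volume_2_le:
  assumes r: "r > 0"
  defines "c \<equiv> measure lborel (nball 0 r)"
  defines "p \<equiv> (1 / 4) ^ DIM('a)" and "h \<equiv> (1 / 2) ^ DIM('a)"
  shows "walk_volume (\<lambda>x y. N (x - y)) (hard_potential N r) 2 \<le> ennreal (c\<^sup>2 * (1 - p * (1 - h)))"
  unfolding walk_volume_def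
proof (rule SUP_least)
  fix v0 :: 'a
  interpret product_sigma_finite "\<lambda>_::nat. lborel :: 'a measure"
    by standard
  let ?W = "walk_weight (\<lambda>x y. N (x - y)) (hard_potential N r)"
  define g :: "'a \<Rightarrow> 'a \<Rightarrow> real" where
    "g x y = of_bool (N (x - v0) < r \<and> N (y - x) < r \<and>
        \<not> (r / 2 \<le> N (x - v0) \<and> N (y - midpoint v0 x) < r / 4))" for x y
  have g_meas: "(\<lambda>(x, y). ennreal (g x y)) \<in> borel_measurable (lborel \<Otimes>\<^sub>M lborel)"
    unfolding g_def midpoint_def by measurable
  have p: "0 \<le> p" "p \<le> 1" and h: "0 \<le> h" "h \<le> 1"
    by (auto simp: p_def h_def intro!: power_le_one)
  have c0: "c \<ge> 0" by (simp add: c_def)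
  have c: "emeasure lborel (nball 0 r) = ennreal c"
    using emeasure_nball_finite[OF r] by (simp add: c_def emeasure_eq_ennreal_measure)
  have c_r: "emeasure lborel (nball v r) = ennreal c" for v
    using emeasure_nball[OF r] c by simp
  have c_half: "emeasure lborel (nball v (r / 2)) = ennreal (h * c)" for v
    using emeasure_nball_scale[of "1 / 2" v r] c h c0 by (simp add: h_def ennreal_mult)
  have c_quarter: "emeasure lborel (nball v (r / 4)) = ennreal (p * c)" for v
    using emeasure_nball_scale[of "1 / 4" v r] c p c0 by (simp add: p_def ennreal_mult)
  have sets: "nball v s \<in> sets lborel" for v s
    using open_nball by auto
  \<comment> \<open>The two values, \<open>c\<close> on the inner ball and
    \<open>c * (1 - p)\<close> on the shell, are written as a combination of ball indicators, so the
    outer integral needs only ball volumes.\<close>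
  have inner: "(\<integral>\<^sup>+ y. ennreal (g x y) \<partial>lborel)
      \<le> ennreal (c * (1 - p)) * indicator (nball v0 r) x + ennreal (c * p) * indicator (nball v0 (r / 2)) x"
    for x
  proof -
    consider "r \<le> N (x - v0)" | "N (x - v0) < r / 2" | "r / 2 \<le> N (x - v0)" "N (x - v0) < r"
      by linarith
    then show ?thesis
    proof cases
      case 1
      then show ?thesis by (simp add: g_def)
    next
      case 2
      have "(\<integral>\<^sup>+ y. ennreal (g x y) \<partial>lborel) = (\<integral>\<^sup>+ y. indicator (nball x r) y \<partial>lborel)"
        using 2 r by (intro nn_integral_cong) (auto simp: g_def indicator_def)
      also have "\<dots> = ennreal c"
        using sets by (simp add: c_r)
      also have "\<dots> = ennreal (c * (1 - p)) + ennreal (c * p)"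
        using c0 p by (subst ennreal_plus[symmetric]) (auto simp: algebra_simps mult_left_le)
      finally show ?thesis using 2 r by simp
    next
      case 3
      \<comment> \<open>The forbidden ball must lie inside the ball around \<open>x\<close> for its
        whole volume to be lost: its centre is less than \<open>r / 2\<close> from \<open>x\<close>
        and its radius is \<open>r / 4\<close>.\<close>
      let ?m = "midpoint v0 x"
      have "?m - x = (1 / 2) *\<^sub>R (v0 - x)"
        by (simp add: midpoint_def algebra_simps flip: scaleR_add_left)
      then have "N (?m - x) < r / 2"
        using 3 minus[of "x - v0"] by (simp add: scale)
      then have "N (y - x) < r" if "N (y - ?m) < r / 4" for y
        using triangle[of "y - ?m" "?m - x"] that r by simp
      then have sub: "nball ?m (r / 4) \<subseteq> nball x r"
        by blast
      have "(\<integral>\<^sup>+ y. ennreal (g x y) \<partial>lborel) = (\<integral>\<^sup>+ y. indicator (nball x r - nball ?m (r / 4)) y \<partial>lborel)"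
        using 3 by (intro nn_integral_cong) (auto simp: g_def indicator_def)
      also have "\<dots> = emeasure lborel (nball x r - nball ?m (r / 4))"
        using sets by (intro nn_integral_indicator) auto
      also have "\<dots> = ennreal c - ennreal (p * c)"
        using emeasure_Diff[OF _ sets sets sub] unfolding c_r c_quarter by (metis ennreal_neq_top infinity_ennreal_def)
      also have "\<dots> = ennreal (c * (1 - p))"
        using c0 p by (simp add: ennreal_minus algebra_simps)
      finally show ?thesis using 3 by simp
    qed
  qed
  have indices: "{1..2} = {1, 2::nat}" by auto
  have "?W 2 (v(0 := v0)) \<le> g (v 1) (v 2)" for v
    using walk_weight_2_le[of r "v(0 := v0)"] by (simp add: g_def)
  then have "(\<integral>\<^sup>+ v. ennreal (?W 2 (v(0 := v0))) \<partial>(\<Pi>\<^sub>M j\<in>{1..2}. lborel))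
      \<le> (\<integral>\<^sup>+ v. ennreal (g (v 1) (v 2)) \<partial>(\<Pi>\<^sub>M j\<in>{1..2::nat}. lborel))"
    by (intro nn_integral_mono ennreal_leI)
  also have "\<dots> = (\<integral>\<^sup>+ x. (\<integral>\<^sup>+ y. ennreal (g x y) \<partial>lborel) \<partial>lborel)"
    using g_meas product_nn_integral_pair[of "\<lambda>x y. ennreal (g x y)" 1 2]
    unfolding indices by (simp add: case_prod_unfold flip: lborel.nn_integral_fst)
  also have "\<dots> \<le> (\<integral>\<^sup>+ x. ennreal (c * (1 - p)) * indicator (nball v0 r) x
      + ennreal (c * p) * indicator (nball v0 (r / 2)) x \<partial>lborel)"
    by (intro nn_integral_mono inner)
  also have "\<dots> = ennreal (c * (1 - p)) * ennreal c + ennreal (c * p) * ennreal (h * c)"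
    using sets by (simp add: nn_integral_add nn_integral_cmult_indicator c_r c_half
        del: less_divide_eq_numeral1)
  also have "\<dots> = ennreal (c\<^sup>2 * (1 - p * (1 - h)))"
  proof -
    have "c * (1 - p) * c + c * p * (h * c) = c\<^sup>2 * (1 - p * (1 - h))"
      by (simp add: algebra_simps power2_eq_square)
    then show ?thesis
      using c0 p h by (simp flip: ennreal_mult ennreal_plus)
  qed
  finally show "(\<integral>\<^sup>+ v. ennreal (?W 2 (v(0 := v0))) \<partial>(\<Pi>\<^sub>M j\<in>{1..2}. lborel))
      \<le> ennreal (c\<^sup>2 * (1 - p * (1 - h)))" .
qed

section \<open>Strict bound on the connective constant\<close>

text \<open>It remains to compare \<open>1 - p * (1 - h)\<close> with
  \<open>(1 - q)\<^sup>2\<close>. The former is at most \<open>1 - p / 2\<close>, the latter at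
  least \<open>1 - 2 * q\<close>, and \<open>2 * q\<close> is at most \<open>p / 4\<close>.\<close>

theorem connective_constant_hard_potential_less:
  assumes r: "r > 0"
  shows "connective_constant (\<lambda>x y. N (x - y)) (hard_potential N r)
           < ennreal (1 - (1/8) ^ (DIM('a) + 1)) * temperedness (hard_potential N r)"
proof -
  define D where "D = DIM('a)"
  define c where "c = measure lborel (nball 0 r)"
  define p h q :: real where "p = (1 / 4) ^ D" and "h = (1 / 2) ^ D" and "q = (1 / 8) ^ (D + 1)"
  define V where "V = walk_volume (\<lambda>x y. N (x - y)) (hard_potential N r) 2"
  have c: "temperedness (hard_potential N r) = ennreal c"
    using emeasure_nball_finite[OF r]
    by (simp add: c_def temperedness_hard_potential[OF r] emeasure_eq_ennreal_measure)
  have c0: "c > 0"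
    using emeasure_nball_pos[OF r] c temperedness_hard_potential[OF r] by simp
  have "h \<le> 1 / 2"
    using power_decreasing[of 1 D "1 / 2 :: real"] by (simp add: h_def D_def Suc_leI)
  moreover have p0: "p > 0" by (simp add: p_def)
  ultimately have "p * (1 / 2) \<le> p * (1 - h)"
    by (intro mult_left_mono) auto
  \<comment> \<open>The extra factor \<open>1 / 8\<close> in \<open>q\<close> turns
    \<open>2 * q\<close> into \<open>(1 / 4) * (1 / 8) ^ D\<close>.\<close>
  moreover have "2 * q \<le> p / 4"
    using power_mono[of "1 / 8" "1 / 4 :: real" D] by (simp add: q_def p_def)
  ultimately have "2 * q < p * (1 - h)"
    using p0 by linarith
  moreover have "1 - 2 * q \<le> (1 - q)\<^sup>2"
    by (simp add: power2_eq_square algebra_simps)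
  ultimately have key: "c\<^sup>2 * (1 - p * (1 - h)) < (c * (1 - q))\<^sup>2"
    using c0 by (simp add: power_mult_distrib)
  have q1: "q < 1"
    unfolding q_def by (rule power_Suc_less_one[of "1 / 8" D, simplified Suc_eq_plus1]) auto
  have "V \<le> ennreal (c\<^sup>2 * (1 - p * (1 - h)))"
    unfolding V_def c_def p_def h_def D_def by (rule walk_volume_2_le[OF r])
  then obtain a where a: "V = ennreal a" "0 \<le> a" "a < (c * (1 - q))\<^sup>2"
    using key c0 q1
    by (cases V) (auto simp: top_unique ennreal_le_iff2 dest: le_less_trans)
  have "connective_constant (\<lambda>x y. N (x - y)) (hard_potential N r) \<le> ennroot 2 V"
    unfolding V_def using c
    by (intro connective_constant_le_root measurable_metric measurable_hard_potential) auto
  also have "ennroot 2 V = ennreal (sqrt a)"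
    using a by (simp add: ennroot_def sqrt_def)
  also have "\<dots> < ennreal (c * (1 - q))"
    using a c0 q1 by (intro ennreal_lessI real_less_lsqrt) auto
  also have "\<dots> = ennreal (1 - q) * ennreal c"
    using c0 q1 by (simp add: mult.commute flip: ennreal_mult)
  finally show ?thesis
    unfolding c q_def D_def .
qed

end

section \<open>The Euclidean and the maximum norm\<close>

theorem lemma12:
  fixes N :: "real ^ 'd \<Rightarrow> real" and r :: real
  assumes "CARD('d) \<ge> 2"
    and "r > 0"
    and "N = norm \<or> N = infnorm"
  shows "connective_constant (\<lambda>x y. N (x - y)) (hard_potential N r)
           < ennreal (1 - (1/8) ^ (CARD('d) + 1)) * temperedness (hard_potential N r)"
proof -
  have "equivalent_norm (norm :: real ^ 'd \<Rightarrow> real) 1"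
    by unfold_locales (auto intro: norm_triangle_ineq continuous_intros)
  \<comment> \<open>\<open>infnorm\<close> is the largest absolute coordinate, so the Euclidean norm
    exceeds it by at most the square root of the dimension as a factor.\<close>
  moreover have "equivalent_norm (infnorm :: real ^ 'd \<Rightarrow> real) (sqrt DIM(real ^ 'd))"
    by unfold_locales
       (auto simp: infnorm_mul simp del: DIM_cart intro: infnorm_triangle continuous_intros norm_le_infnorm)
  ultimately obtain K where "equivalent_norm N K"
    using assms(3) by blast
  from equivalent_norm.connective_constant_hard_potential_less[OF this assms(2)]
  show ?thesis by simp
qed

end
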